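(* Let $P_{tT}$ be an admissible, arbitrage-free family of discount bond price processes with absolute volatility $\Sigma_{tT}$, short rate $r_t$ and market price of risk $\lambda_t$, and let $\rho_t(x)=-\partial_xP_{t,t+x}$. Assume that $\lim_{x\to\infty}x^n\rho_t(x)=0$ and $\lim_{x\to\infty}x^n\Sigma_{t,t+x}=0$ for $n=1,2$, and that the integrals $\int_0^\infty x^n\rho_t(x)\,\mathrm{d}x$ and $\int_0^\infty x^{n-1}\Sigma_{t,t+x}\,\mathrm{d}x$ exist for $n=1,2$. Then the first principal moment $\bar x_t=\int_0^\infty x\rho_t(x)\,\mathrm{d}x$ satisfies $$\mathrm{d}\bar x_t=(r_t\bar x_t-1)\,\mathrm{d}t+\bar\Sigma_t\cdot\mathrm{d}W^*_t,$$ where $\bar\Sigma_t=\int_0^\infty\Sigma_{t,t+x}\,\mathrm{d}x$ and $\mathrm{d}W^*_t=\mathrm{d}W_t+\lambda_t\,\mathrm{d}t$.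
   Context: Discount bonds: $P_{tT}$ ($0\le t\le T<\infty$) is the value at time $t$ of a bond paying one unit at time $T$. On a filtered probability space generated by a (vector) Brownian motion $W_t$, the bond prices have dynamics $\mathrm{d}P_{tT}=\mu_{tT}\,\mathrm{d}t+\Sigma_{tT}\cdot\mathrm{d}W_t$, where the adapted absolute drift $\mu_{tT}$ (scalar) and absolute volatility $\Sigma_{tT}$ (vector) are smooth in $T$, and $\cdot$ is the inner product of vectors. Admissible: for each $t$, $P_{tt}=1$, $0<P_{tT}\le1$, $P_{tT}$ is smooth in $T$ with $\partial_TP_{tT}<0$, and $P_{tT}\to0$ as $T\to\infty$. Thus $\rho_t(\cdot)$ is a probability density on $[0,\infty)$ for each $t$. Short rate: $r_t=-\partial_TP_{tT}|_{T=t}=\rho_t(0)$. Arbitrage-free: there is an adapted vector process $\lambda_t$ (the market price of risk), not depending on $T$, with $\mu_{tT}=r_tP_{tT}+\Sigma_{tT}\cdot\lambda_t$ for all $t\le T$. Standing assumptions: $\Sigma_{tt}=0$; and sufficiently strong technical regularity conditions hold that the instantaneous forward rate processes are semimartingales, that $\mathrm{d}(P_{t,t+x})=\mathrm{d}P_{tT}|_{T=t+x}+\partial_xP_{t,t+x}\,\mathrm{d}t$, and that stochastic differentials depending on the parameter $x$ may be differentiated and integrated in $x$ under the integral signs. *)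

theory Defs
  imports "HOL-Probability.Probability"
begin

section \<open>Processes over a filtration\<close>

text \<open>
  A process is a function of time and outcome. The set \<open>J\<close> is its time interval, always
  \<open>{0..}\<close> or \<open>{0..T}\<close>; values at times outside \<open>J\<close> are irrelevant.
\<close>

text \<open>Natural filtration of \<open>W\<close>, augmented by the null sets of \<open>M\<close>.\<close>

definition brownian_filtration ::
  "'w measure \<Rightarrow> (real \<Rightarrow> 'w \<Rightarrow> real^'d) \<Rightarrow> real \<Rightarrow> 'w measure" where
  "brownian_filtration M W t = sigma (space M)
     ({W s -` B \<inter> space M | s B. s \<in> {0..t} \<and> B \<in> sets borel} \<union> null_sets M)"

definition brownian_motion :: "'w measure \<Rightarrow> (real \<Rightarrow> 'w \<Rightarrow> real^'d) \<Rightarrow> bool" where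
  "brownian_motion M W \<longleftrightarrow>
     prob_space M \<and>
     (\<forall>t\<ge>0. W t \<in> borel_measurable M) \<and>
     (AE \<omega> in M. W 0 \<omega> = 0) \<and>
     (AE \<omega> in M. continuous_on {0..} (\<lambda>t. W t \<omega>)) \<and>
     (\<forall>s t. 0 \<le> s \<and> s < t \<longrightarrow>
        distributed M lborel (\<lambda>\<omega>. W t \<omega> - W s \<omega>)
          (\<lambda>z. ennreal (\<Prod>i\<in>UNIV. normal_density 0 (sqrt (t - s)) (z $ i))) \<and>
        prob_space.indep_set M (sets (brownian_filtration M W s))
          {(\<lambda>\<omega>. W t \<omega> - W s \<omega>) -` B \<inter> space M | B. B \<in> sets borel})"

definition adapted ::
  "(real \<Rightarrow> 'w measure) \<Rightarrow> real set \<Rightarrow> (real \<Rightarrow> 'w \<Rightarrow> 'b::topological_space) \<Rightarrow> bool" where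
  "adapted F J X \<longleftrightarrow> (\<forall>t\<in>J. X t \<in> borel_measurable (F t))"

definition progressive ::
  "(real \<Rightarrow> 'w measure) \<Rightarrow> real set \<Rightarrow> (real \<Rightarrow> 'w \<Rightarrow> 'b::topological_space) \<Rightarrow> bool" where
  "progressive F J X \<longleftrightarrow>
     (\<forall>t\<in>J. (\<lambda>(s, \<omega>). X s \<omega>) \<in> borel_measurable (restrict_space borel {0..t} \<Otimes>\<^sub>M F t))"

text \<open>For measurable random variables only: a non-measurable event would get measure 0.\<close>

definition tendsto_in_probability ::
  "'w measure \<Rightarrow> (nat \<Rightarrow> 'w \<Rightarrow> real) \<Rightarrow> ('w \<Rightarrow> real) \<Rightarrow> bool" where
  "tendsto_in_probability M Z Y \<longleftrightarrow>
     (\<forall>\<epsilon>>0. (\<lambda>k. measure M {\<omega> \<in> space M. \<epsilon> < \<bar>Z k \<omega> - Y \<omega>\<bar>}) \<longlonglongrightarrow> 0)"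


section \<open>The Ito integral and stochastic differentials\<close>

definition elementary ::
  "(real \<Rightarrow> 'w measure) \<Rightarrow> nat \<Rightarrow> (nat \<Rightarrow> real) \<Rightarrow> (nat \<Rightarrow> 'w \<Rightarrow> real^'d) \<Rightarrow> bool" where
  "elementary F n \<tau> \<xi> \<longleftrightarrow>
     0 \<le> \<tau> 0 \<and>
     (\<forall>i<n. \<tau> i \<le> \<tau> (Suc i) \<and> \<xi> i \<in> borel_measurable (F (\<tau> i)) \<and>
        (\<exists>C. \<forall>\<omega>\<in>space (F (\<tau> i)). norm (\<xi> i \<omega>) \<le> C))"

definition elementary_process ::
  "nat \<Rightarrow> (nat \<Rightarrow> real) \<Rightarrow> (nat \<Rightarrow> 'w \<Rightarrow> real^'d) \<Rightarrow> real \<Rightarrow> 'w \<Rightarrow> real^'d" where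
  "elementary_process n \<tau> \<xi> t \<omega> = (\<Sum>i<n. indicat_real {\<tau> i<..\<tau> (Suc i)} t *\<^sub>R \<xi> i \<omega>)"

definition elementary_integral ::
  "(real \<Rightarrow> 'w \<Rightarrow> real^'d) \<Rightarrow> nat \<Rightarrow> (nat \<Rightarrow> real) \<Rightarrow> (nat \<Rightarrow> 'w \<Rightarrow> real^'d) \<Rightarrow> real \<Rightarrow> 'w \<Rightarrow> real" where
  "elementary_integral W n \<tau> \<xi> t \<omega> =
     (\<Sum>i<n. \<xi> i \<omega> \<bullet> (W (min t (\<tau> (Suc i))) \<omega> - W (min t (\<tau> i)) \<omega>))"

text \<open>
  \<open>I\<close> is a continuous version of \<open>\<integral>\<^sub>0\<^sup>t H\<^sub>s \<cdot> dW\<^sub>s\<close>, for progressive \<open>H\<close> with paths almost surely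
  locally square integrable. The limit in probability does not depend on the approximating
  sequence, so \<open>I\<close> is unique up to indistinguishability.
\<close>

definition ito_integral ::
  "'w measure \<Rightarrow> (real \<Rightarrow> 'w measure) \<Rightarrow> (real \<Rightarrow> 'w \<Rightarrow> real^'d) \<Rightarrow> real set \<Rightarrow>
   (real \<Rightarrow> 'w \<Rightarrow> real^'d) \<Rightarrow> (real \<Rightarrow> 'w \<Rightarrow> real) \<Rightarrow> bool" where
  "ito_integral M F W J H I \<longleftrightarrow>
     progressive F J H \<and>
     (AE \<omega> in M. \<forall>t\<in>J. set_integrable lborel {0..t} (\<lambda>s. (norm (H s \<omega>))\<^sup>2)) \<and>
     adapted F J I \<and>
     (AE \<omega> in M. continuous_on J (\<lambda>t. I t \<omega>)) \<and>
     (\<exists>n \<tau> \<xi>. (\<forall>k. elementary F (n k) (\<tau> k) (\<xi> k)) \<and>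
        (\<forall>t\<in>J.
           tendsto_in_probability M
             (\<lambda>k \<omega>. LINT s:{0..t}|lborel.
                (norm (elementary_process (n k) (\<tau> k) (\<xi> k) s \<omega> - H s \<omega>))\<^sup>2)
             (\<lambda>\<omega>. 0) \<and>
           tendsto_in_probability M
             (\<lambda>k. elementary_integral W (n k) (\<tau> k) (\<xi> k) t) (I t)))"

text \<open>
  \<open>dX\<^sub>t = a\<^sub>t dt + b\<^sub>t \<cdot> dW\<^sub>t\<close> on \<open>J\<close>. All processes are identified up to indistinguishability:
  \<open>a\<close> and \<open>b\<close> need only agree with progressive processes outside a null set of outcomes.
\<close>

definition has_ito_differential ::
  "'w measure \<Rightarrow> (real \<Rightarrow> 'w measure) \<Rightarrow> (real \<Rightarrow> 'w \<Rightarrow> real^'d) \<Rightarrow> real set \<Rightarrow>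
   (real \<Rightarrow> 'w \<Rightarrow> real) \<Rightarrow> (real \<Rightarrow> 'w \<Rightarrow> real) \<Rightarrow> (real \<Rightarrow> 'w \<Rightarrow> real^'d) \<Rightarrow> bool" where
  "has_ito_differential M F W J X a b \<longleftrightarrow>
     (\<exists>\<xi> \<alpha> \<beta> I.
        \<xi> \<in> borel_measurable (F 0) \<and> progressive F J \<alpha> \<and> ito_integral M F W J \<beta> I \<and>
        (AE \<omega> in M. \<forall>t\<in>J.
           a t \<omega> = \<alpha> t \<omega> \<and> b t \<omega> = \<beta> t \<omega> \<and>
           set_integrable lborel {0..t} (\<lambda>s. \<alpha> s \<omega>) \<and>
           X t \<omega> = \<xi> \<omega> + (LINT s:{0..t}|lborel. \<alpha> s \<omega>) + I t \<omega>))"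

text \<open>\<open>dX\<^sub>t = a\<^sub>t dt + b\<^sub>t \<cdot> dW\<^sup>*\<^sub>t\<close>, where \<open>dW\<^sup>*\<^sub>t = dW\<^sub>t + \<lambda>\<^sub>t dt\<close>.\<close>

definition has_ito_differential_star ::
  "'w measure \<Rightarrow> (real \<Rightarrow> 'w measure) \<Rightarrow> (real \<Rightarrow> 'w \<Rightarrow> real^'d) \<Rightarrow> (real \<Rightarrow> 'w \<Rightarrow> real^'d) \<Rightarrow>
   real set \<Rightarrow> (real \<Rightarrow> 'w \<Rightarrow> real) \<Rightarrow> (real \<Rightarrow> 'w \<Rightarrow> real) \<Rightarrow> (real \<Rightarrow> 'w \<Rightarrow> real^'d) \<Rightarrow> bool" where
  "has_ito_differential_star M F W lam J X a b \<longleftrightarrow>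
     has_ito_differential M F W J X (\<lambda>t \<omega>. a t \<omega> + b t \<omega> \<bullet> lam t \<omega>) b"


section \<open>Semimartingales\<close>

definition martingale ::
  "'w measure \<Rightarrow> (real \<Rightarrow> 'w measure) \<Rightarrow> real set \<Rightarrow> (real \<Rightarrow> 'w \<Rightarrow> real) \<Rightarrow> bool" where
  "martingale M F J N \<longleftrightarrow>
     adapted F J N \<and> (\<forall>t\<in>J. integrable M (N t)) \<and>
     (\<forall>s\<in>J. \<forall>t\<in>J. s \<le> t \<longrightarrow> (AE \<omega> in M. real_cond_exp M (F s) (N t) \<omega> = N s \<omega>))"

definition cadlag_on :: "real set \<Rightarrow> (real \<Rightarrow> real) \<Rightarrow> bool" where
  "cadlag_on J f \<longleftrightarrow>
     (\<forall>t\<in>J. continuous (at t within {t..} \<inter> J) f \<and>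
        (\<exists>l. (f \<longlongrightarrow> l) (at t within {..<t} \<inter> J)))"

definition local_martingale ::
  "'w measure \<Rightarrow> (real \<Rightarrow> 'w measure) \<Rightarrow> real set \<Rightarrow> (real \<Rightarrow> 'w \<Rightarrow> real) \<Rightarrow> bool" where
  "local_martingale M F J N \<longleftrightarrow>
     adapted F J N \<and> (\<forall>\<omega>\<in>space M. cadlag_on J (\<lambda>t. N t \<omega>)) \<and>
     (\<exists>\<tau>::nat \<Rightarrow> 'w \<Rightarrow> real.
        (\<forall>k. stopping_time F (\<tau> k) \<and> (\<forall>\<omega>\<in>space M. 0 \<le> \<tau> k \<omega>)) \<and>
        (AE \<omega> in M. incseq (\<lambda>k. \<tau> k \<omega>) \<and> (\<forall>t\<in>J. \<forall>\<^sub>F k in sequentially. t \<le> \<tau> k \<omega>)) \<and>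
        (\<forall>k. martingale M F J (\<lambda>t \<omega>. N (min t (\<tau> k \<omega>)) \<omega> - N 0 \<omega>)))"

text \<open>The finite variation part is written as a difference of adapted nondecreasing processes.\<close>

definition semimartingale ::
  "'w measure \<Rightarrow> (real \<Rightarrow> 'w measure) \<Rightarrow> real set \<Rightarrow> (real \<Rightarrow> 'w \<Rightarrow> real) \<Rightarrow> bool" where
  "semimartingale M F J X \<longleftrightarrow>
     (\<exists>N A B. local_martingale M F J N \<and> adapted F J A \<and> adapted F J B \<and>
        (\<forall>\<omega>\<in>space M. cadlag_on J (\<lambda>t. A t \<omega>) \<and> mono_on J (\<lambda>t. A t \<omega>) \<and>
           cadlag_on J (\<lambda>t. B t \<omega>) \<and> mono_on J (\<lambda>t. B t \<omega>)) \<and>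
        (AE \<omega> in M. \<forall>t\<in>J. X t \<omega> = N t \<omega> + A t \<omega> - B t \<omega>))"


section \<open>Stochastic differentials depending on a parameter\<close>

text \<open>Infinitely differentiable on \<open>{c..}\<close>, with one-sided derivatives at \<open>c\<close>.\<close>

definition smooth_from :: "real \<Rightarrow> (real \<Rightarrow> 'b::real_normed_vector) \<Rightarrow> bool" where
  "smooth_from c f \<longleftrightarrow>
     (\<exists>D :: nat \<Rightarrow> real \<Rightarrow> 'b. (\<forall>x\<ge>c. D 0 x = f x) \<and>
        (\<forall>k. \<forall>x\<ge>c. (D k has_vector_derivative D (Suc k) x) (at x within {c..})))"

definition deriv_from :: "real \<Rightarrow> (real \<Rightarrow> 'b::real_normed_vector) \<Rightarrow> real \<Rightarrow> 'b" where
  "deriv_from c f x = vector_derivative f (at x within {c..})"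

text \<open>
  Permission to differentiate, respectively integrate, under the integral signs the differentials
  \<open>dX\<^sub>t(x) = a\<^sub>t(x) dt + b\<^sub>t(x) \<cdot> dW\<^sub>t\<close>, \<open>x \<ge> 0\<close>, of one family; the parameter \<open>x\<close> is the first
  argument. In the second definition integrals over \<open>x\<close> are gauge integrals and so include
  conditionally convergent improper integrals.
\<close>

definition differentiable_under_integral_signs ::
  "'w measure \<Rightarrow> (real \<Rightarrow> 'w measure) \<Rightarrow> (real \<Rightarrow> 'w \<Rightarrow> real^'d) \<Rightarrow>
   (real \<Rightarrow> real \<Rightarrow> 'w \<Rightarrow> real) \<Rightarrow> (real \<Rightarrow> real \<Rightarrow> 'w \<Rightarrow> real) \<Rightarrow> (real \<Rightarrow> real \<Rightarrow> 'w \<Rightarrow> real^'d) \<Rightarrow> bool"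
where
  "differentiable_under_integral_signs M F W X a b \<longleftrightarrow>
     ((\<forall>x\<ge>0. has_ito_differential M F W {0..} (X x) (a x) (b x)) \<and>
      (AE \<omega> in M. \<forall>t\<ge>0. smooth_from 0 (\<lambda>x. X x t \<omega>) \<and> smooth_from 0 (\<lambda>x. a x t \<omega>) \<and>
         smooth_from 0 (\<lambda>x. b x t \<omega>))
      \<longrightarrow> (\<forall>x\<ge>0. has_ito_differential M F W {0..}
            (\<lambda>t \<omega>. deriv_from 0 (\<lambda>y. X y t \<omega>) x)
            (\<lambda>t \<omega>. deriv_from 0 (\<lambda>y. a y t \<omega>) x)
            (\<lambda>t \<omega>. deriv_from 0 (\<lambda>y. b y t \<omega>) x)))"

definition integrable_under_integral_signs ::
  "'w measure \<Rightarrow> (real \<Rightarrow> 'w measure) \<Rightarrow> (real \<Rightarrow> 'w \<Rightarrow> real^'d) \<Rightarrow>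
   (real \<Rightarrow> real \<Rightarrow> 'w \<Rightarrow> real) \<Rightarrow> (real \<Rightarrow> real \<Rightarrow> 'w \<Rightarrow> real) \<Rightarrow> (real \<Rightarrow> real \<Rightarrow> 'w \<Rightarrow> real^'d) \<Rightarrow> bool"
where
  "integrable_under_integral_signs M F W X a b \<longleftrightarrow>
     ((\<forall>x\<ge>0. has_ito_differential M F W {0..} (X x) (a x) (b x)) \<and>
      (AE \<omega> in M. \<forall>t\<ge>0. (\<lambda>x. X x t \<omega>) integrable_on {0..} \<and> (\<lambda>x. a x t \<omega>) integrable_on {0..} \<and>
         (\<lambda>x. b x t \<omega>) integrable_on {0..})
      \<longrightarrow> has_ito_differential M F W {0..}
            (\<lambda>t \<omega>. integral {0..} (\<lambda>x. X x t \<omega>))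
            (\<lambda>t \<omega>. integral {0..} (\<lambda>x. a x t \<omega>))
            (\<lambda>t \<omega>. integral {0..} (\<lambda>x. b x t \<omega>)))"


section \<open>Discount bonds\<close>

text \<open>
  \<open>P t T \<omega>\<close>, \<open>mu t T \<omega>\<close> and \<open>Sig t T \<omega>\<close> are the price at time \<open>t\<close> of the bond maturing at \<open>T\<close>, its
  absolute drift and its absolute volatility. They matter only for \<open>0 \<le> t \<le> T\<close>.
\<close>

definition admissible :: "'w measure \<Rightarrow> (real \<Rightarrow> real \<Rightarrow> 'w \<Rightarrow> real) \<Rightarrow> bool" where
  "admissible M P \<longleftrightarrow>
     (AE \<omega> in M. \<forall>t\<ge>0.
        P t t \<omega> = 1 \<and>
        (\<forall>T\<ge>t. 0 < P t T \<omega> \<and> P t T \<omega> \<le> 1) \<and>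
        smooth_from t (\<lambda>T. P t T \<omega>) \<and>
        (\<forall>T\<ge>t. deriv_from t (\<lambda>S. P t S \<omega>) T < 0) \<and>
        ((\<lambda>T. P t T \<omega>) \<longlongrightarrow> 0) at_top)"

definition bond_dynamics ::
  "'w measure \<Rightarrow> (real \<Rightarrow> 'w measure) \<Rightarrow> (real \<Rightarrow> 'w \<Rightarrow> real^'d) \<Rightarrow>
   (real \<Rightarrow> real \<Rightarrow> 'w \<Rightarrow> real) \<Rightarrow> (real \<Rightarrow> real \<Rightarrow> 'w \<Rightarrow> real) \<Rightarrow> (real \<Rightarrow> real \<Rightarrow> 'w \<Rightarrow> real^'d) \<Rightarrow> bool"
where
  "bond_dynamics M F W P mu Sig \<longleftrightarrow>
     (\<forall>T\<ge>0. adapted F {0..T} (\<lambda>t. mu t T) \<and> adapted F {0..T} (\<lambda>t. Sig t T) \<and>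
        has_ito_differential M F W {0..T} (\<lambda>t. P t T) (\<lambda>t. mu t T) (\<lambda>t. Sig t T)) \<and>
     (AE \<omega> in M. \<forall>t\<ge>0. smooth_from t (\<lambda>T. mu t T \<omega>) \<and> smooth_from t (\<lambda>T. Sig t T \<omega>))"

definition term_density :: "(real \<Rightarrow> real \<Rightarrow> 'w \<Rightarrow> real) \<Rightarrow> real \<Rightarrow> real \<Rightarrow> 'w \<Rightarrow> real" where
  "term_density P t x \<omega> = - deriv_from 0 (\<lambda>y. P t (t + y) \<omega>) x"

definition short_rate :: "(real \<Rightarrow> real \<Rightarrow> 'w \<Rightarrow> real) \<Rightarrow> real \<Rightarrow> 'w \<Rightarrow> real" where
  "short_rate P t \<omega> = - deriv_from t (\<lambda>T. P t T \<omega>) t"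

definition forward_rate :: "(real \<Rightarrow> real \<Rightarrow> 'w \<Rightarrow> real) \<Rightarrow> real \<Rightarrow> real \<Rightarrow> 'w \<Rightarrow> real" where
  "forward_rate P t T \<omega> = - deriv_from t (\<lambda>S. ln (P t S \<omega>)) T"

definition market_price_of_risk ::
  "'w measure \<Rightarrow> (real \<Rightarrow> 'w measure) \<Rightarrow> (real \<Rightarrow> real \<Rightarrow> 'w \<Rightarrow> real) \<Rightarrow> (real \<Rightarrow> real \<Rightarrow> 'w \<Rightarrow> real) \<Rightarrow>
   (real \<Rightarrow> real \<Rightarrow> 'w \<Rightarrow> real^'d) \<Rightarrow> (real \<Rightarrow> 'w \<Rightarrow> real^'d) \<Rightarrow> bool" where
  "market_price_of_risk M F P mu Sig lam \<longleftrightarrow>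
     adapted F {0..} lam \<and>
     (AE \<omega> in M. \<forall>t\<ge>0. \<forall>T\<ge>t.
        mu t T \<omega> = short_rate P t \<omega> * P t T \<omega> + Sig t T \<omega> \<bullet> lam t \<omega>)"

text \<open>
  The drift of \<open>P\<^sub>t\<^sub>,\<^sub>t\<^sub>+\<^sub>x\<close> for fixed time to maturity \<open>x\<close> is
  \<open>\<mu>\<^sub>t\<^sub>,\<^sub>t\<^sub>+\<^sub>x + \<partial>\<^sub>x P\<^sub>t\<^sub>,\<^sub>t\<^sub>+\<^sub>x\<close>.
\<close>

definition maturity_drift ::
  "(real \<Rightarrow> real \<Rightarrow> 'w \<Rightarrow> real) \<Rightarrow> (real \<Rightarrow> real \<Rightarrow> 'w \<Rightarrow> real) \<Rightarrow> real \<Rightarrow> real \<Rightarrow> 'w \<Rightarrow> real" where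
  "maturity_drift P mu x t \<omega> = mu t (t + x) \<omega> + deriv_from 0 (\<lambda>y. P t (t + y) \<omega>) x"

text \<open>
  The interchange conditions are imposed on particular families only, since they fail for
  arbitrary ones: differentiation for \<open>P\<^sub>t\<^sub>,\<^sub>t\<^sub>+\<^sub>x\<close>, integration for \<open>x \<rho>\<^sub>t(x)\<close>, whose coefficients
  are \<open>- x\<close> times the \<open>x\<close>-derivatives of those of \<open>P\<^sub>t\<^sub>,\<^sub>t\<^sub>+\<^sub>x\<close>.
\<close>

definition regularity_conditions ::
  "'w measure \<Rightarrow> (real \<Rightarrow> 'w measure) \<Rightarrow> (real \<Rightarrow> 'w \<Rightarrow> real^'d) \<Rightarrow>
   (real \<Rightarrow> real \<Rightarrow> 'w \<Rightarrow> real) \<Rightarrow> (real \<Rightarrow> real \<Rightarrow> 'w \<Rightarrow> real) \<Rightarrow> (real \<Rightarrow> real \<Rightarrow> 'w \<Rightarrow> real^'d) \<Rightarrow> bool"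
where
  "regularity_conditions M F W P mu Sig \<longleftrightarrow>
     (\<forall>T\<ge>0. semimartingale M F {0..T} (\<lambda>t. forward_rate P t T)) \<and>
     (\<forall>x\<ge>0. has_ito_differential M F W {0..}
        (\<lambda>t. P t (t + x)) (maturity_drift P mu x) (\<lambda>t. Sig t (t + x))) \<and>
     differentiable_under_integral_signs M F W
       (\<lambda>x t. P t (t + x)) (maturity_drift P mu) (\<lambda>x t. Sig t (t + x)) \<and>
     integrable_under_integral_signs M F W
       (\<lambda>x t \<omega>. x * term_density P t x \<omega>)
       (\<lambda>x t \<omega>. - x * deriv_from 0 (\<lambda>y. maturity_drift P mu y t \<omega>) x)
       (\<lambda>x t \<omega>. - x *\<^sub>R deriv_from 0 (\<lambda>y. Sig t (t + y) \<omega>) x)"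

end

theory Submission
  imports Defs
begin

text \<open>
  Differentiating the dynamics of \<open>P\<^sub>t\<^sub>,\<^sub>t\<^sub>+\<^sub>x\<close> in \<open>x\<close>, multiplying by \<open>- x\<close> and integrating over
  \<open>x\<close> gives the dynamics of the first moment, with drift \<open>- \<integral> x d'(x) dx\<close> and volatility
  \<open>- \<integral> x \<partial>\<^sub>x \<Sigma>\<^sub>t\<^sub>,\<^sub>t\<^sub>+\<^sub>x dx\<close>, where \<open>d = r p + \<Sigma> \<cdot> \<lambda> + p'\<close> and \<open>p(x) = P\<^sub>t\<^sub>,\<^sub>t\<^sub>+\<^sub>x\<close>. Integration by
  parts turns the volatility into \<open>\<integral> \<Sigma>\<close>. In the drift, \<open>- x r p'\<close> is \<open>r\<close> times the integrand of
  the first moment, while the two other terms, by parts again, integrate to \<open>(\<integral> \<Sigma>) \<cdot> \<lambda>\<close> and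
  \<open>\<integral> p' = - 1\<close>.
\<close>

section \<open>Calculus on a half line\<close>

text \<open>A derivative is gauge integrable on every compact interval, and over an unbounded set
  the gauge integral is the limit along growing boxes. Convergence of \<open>g\<close> at infinity
  therefore suffices, even if the integral converges only conditionally.\<close>

lemma fundamental_theorem_of_calculus_at_top:
  fixes f :: "real \<Rightarrow> 'a::banach"
  assumes deriv: "\<And>x. a \<le> x \<Longrightarrow> (g has_vector_derivative f x) (at x within {a..})"
    and lim: "(g \<longlongrightarrow> L) at_top"
  shows "(f has_integral (L - g a)) {a..}"
proof -
  have finite_part: "(f has_integral (g b - g a)) {a..b}" if "a \<le> b" for b
    using that by (intro fundamental_theorem_of_calculus)
      (auto intro: has_vector_derivative_within_subset[OF deriv])
  have restrict: "((\<lambda>x. if x \<in> {a..} then f x else 0) has_integral z) (cbox u v) \<longleftrightarrow>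
      (f has_integral z) {max a u..v}" for u v z
  proof -
    have "{a..} \<inter> cbox u v = {max a u..v}" by auto
    then show ?thesis by (simp only: has_integral_restrict_Int)
  qed
  show ?thesis
  proof (subst has_integral', intro allI impI)
    fix e :: real
    assume "0 < e"
    with lim obtain N where N: "\<And>b. N \<le> b \<Longrightarrow> dist (g b) L < e"
      unfolding tendsto_iff eventually_at_top_linorder by blast
    \<comment> \<open>The two points -(|a| + |N|) and |a| + |N| must lie in any box containing the
      ball, which forces u <= a, a <= v and N <= v. The summand 1 puts them inside the open
      ball.\<close>
    define B where "B = \<bar>a\<bar> + \<bar>N\<bar> + 1"
    have "\<exists>z. ((\<lambda>x. if x \<in> {a..} then f x else 0) has_integral z) (cbox u v) \<and>
        norm (z - (L - g a)) < e" if sub: "ball 0 B \<subseteq> cbox u v" for u v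
    proof -
      have "- (\<bar>a\<bar> + \<bar>N\<bar>) \<in> ball 0 B" "\<bar>a\<bar> + \<bar>N\<bar> \<in> ball 0 B" by (auto simp: B_def)
      with sub have "- (\<bar>a\<bar> + \<bar>N\<bar>) \<in> cbox u v" "\<bar>a\<bar> + \<bar>N\<bar> \<in> cbox u v" by blast+
      then have "max a u = a" "a \<le> v" "N \<le> v" by (auto simp: max_def)
      then have "((\<lambda>x. if x \<in> {a..} then f x else 0) has_integral (g v - g a)) (cbox u v)"
        by (simp only: restrict finite_part)
      moreover have "norm ((g v - g a) - (L - g a)) < e"
        using N[OF \<open>N \<le> v\<close>] by (simp add: dist_norm)
      ultimately show ?thesis by blast
    qed
    moreover have "0 < B" by (simp add: B_def)
    ultimately show "\<exists>B>0. \<forall>u v. ball 0 B \<subseteq> cbox u v \<longrightarrow>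
        (\<exists>z. ((\<lambda>x. if x \<in> {a..} then f x else 0) has_integral z) (cbox u v) \<and>
          norm (z - (L - g a)) < e)"
      by blast
  qed
qed

text \<open>The product x f(x) has derivative f + x f' and vanishes at 0 through the factor x and at
  infinity by \<open>lim\<close>, so f + x f' integrates to 0. Subtracting this from f also yields
  the existence of the integral of x f'.\<close>

lemma has_integral_times_deriv_by_parts:
  fixes f :: "real \<Rightarrow> 'a::banach"
  assumes deriv: "\<And>x. 0 \<le> x \<Longrightarrow> (f has_vector_derivative f' x) (at x within {0..})"
    and lim: "((\<lambda>x. x *\<^sub>R f x) \<longlongrightarrow> 0) at_top"
    and int: "(f has_integral I) {0..}"
  shows "((\<lambda>x. - x *\<^sub>R f' x) has_integral I) {0..}"
proof -
  have "((\<lambda>x. x *\<^sub>R f x) has_vector_derivative f x + x *\<^sub>R f' x) (at x within {0..})"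
    if "0 \<le> x" for x
    using deriv[OF that] by (auto intro!: derivative_eq_intros)
  from fundamental_theorem_of_calculus_at_top[OF this lim]
  have "((\<lambda>x. f x + x *\<^sub>R f' x) has_integral 0) {0..}" by simp
  from has_integral_diff[OF int this] show ?thesis by simp
qed

text \<open>Derivatives within {c..} are unique because each of its points, the endpoint c included,
  is a limit point from the right.\<close>

lemma deriv_from_eq:
  assumes "(f has_vector_derivative f') (at x within {c..})" "c \<le> x"
  shows "deriv_from c f x = f'"
proof -
  have "x islimpt {x..x + 1}" by (simp add: islimpt_Icc)
  then have "x islimpt {c..}" by (rule islimpt_subset) (use assms(2) in auto)
  then show ?thesis
    unfolding deriv_from_def
    by (intro vector_derivative_within assms(1)) (simp add: trivial_limit_within)
qed

lemma smooth_from_has_deriv_from: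
  assumes "smooth_from c f" "c \<le> x"
  shows "(f has_vector_derivative deriv_from c f x) (at x within {c..})"
proof -
  obtain D where D: "\<forall>x\<ge>c. D 0 x = f x"
    "\<And>k x. c \<le> x \<Longrightarrow> (D k has_vector_derivative D (Suc k) x) (at x within {c..})"
    using assms(1) unfolding smooth_from_def by blast
  \<comment> \<open>\<open>D 0\<close> agrees with \<open>f\<close> only on {c..}; a derivative
    within {c..} sees no other points.\<close>
  have "(f has_vector_derivative D (Suc 0) x) (at x within {c..})"
    by (rule has_vector_derivative_transform[OF _ _ D(2)]) (use assms(2) D(1) in auto)
  with deriv_from_eq[OF this assms(2)] show ?thesis by simp
qed

lemma smooth_from_deriv_from:
  assumes "smooth_from c f"
  shows "smooth_from c (deriv_from c f)"
proof -
  obtain D where D: "\<forall>x\<ge>c. D 0 x = f x"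
    "\<And>k x. c \<le> x \<Longrightarrow> (D k has_vector_derivative D (Suc k) x) (at x within {c..})"
    using assms unfolding smooth_from_def by blast
  have "D (Suc 0) x = deriv_from c f x" if "c \<le> x" for x
  proof (rule sym, rule deriv_from_eq)
    show "(f has_vector_derivative D (Suc 0) x) (at x within {c..})"
      by (rule has_vector_derivative_transform[OF _ _ D(2)]) (use that D(1) in auto)
  qed fact
  then show ?thesis
    unfolding smooth_from_def by (intro exI[of _ "\<lambda>k. D (Suc k)"]) (use D(2) in auto)
qed

lemma smooth_from_add:
  assumes "smooth_from c f" "smooth_from c g"
  shows "smooth_from c (\<lambda>x. f x + g x)"
proof -
  obtain D where "\<forall>x\<ge>c. D 0 x = f x"
    "\<forall>k. \<forall>x\<ge>c. (D k has_vector_derivative D (Suc k) x) (at x within {c..})"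
    using assms(1) unfolding smooth_from_def by blast
  moreover obtain E where "\<forall>x\<ge>c. E 0 x = g x"
    "\<forall>k. \<forall>x\<ge>c. (E k has_vector_derivative E (Suc k) x) (at x within {c..})"
    using assms(2) unfolding smooth_from_def by blast
  ultimately show ?thesis
    unfolding smooth_from_def
    by (intro exI[of _ "\<lambda>k x. D k x + E k x"]) (auto intro!: has_vector_derivative_add)
qed

lemma smooth_from_shift:
  fixes f :: "real \<Rightarrow> 'a::real_normed_vector"
  assumes "smooth_from t f"
  shows "smooth_from 0 (\<lambda>x. f (t + x))"
proof -
  obtain D where D: "\<forall>x\<ge>t. D 0 x = f x"
    "\<And>k x. t \<le> x \<Longrightarrow> (D k has_vector_derivative D (Suc k) x) (at x within {t..})"
    using assms unfolding smooth_from_def by blast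
  have "((\<lambda>x. D k (t + x)) has_vector_derivative D (Suc k) (t + x)) (at x within {0..})"
    if "0 \<le> x" for k x
  proof -
    have "((\<lambda>x. t + x) has_vector_derivative 1) (at x within {0..})"
      by (auto intro!: derivative_eq_intros)
    \<comment> \<open>The chain rule asks for the derivative within the image of {0..} under the
      translation, which lies in {t..}.\<close>
    moreover have "(D k has_vector_derivative D (Suc k) (t + x)) (at (t + x) within (\<lambda>x. t + x) ` {0..})"
      by (rule has_vector_derivative_within_subset[OF D(2)]) (use that in auto)
    ultimately show ?thesis
      using vector_diff_chain_within by (fastforce simp: o_def)
  qed
  then show ?thesis
    unfolding smooth_from_def by (intro exI[of _ "\<lambda>k x. D k (t + x)"]) (use D(1) in auto)
qed

section \<open>Rules for Ito differentials\<close>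

text \<open>A deviation above \<epsilon> after scaling is a deviation above \<epsilon>/|c| before
  it. The separate case c = 0 does occur: the factor applied later is - x, at x = 0 too.\<close>

lemma tendsto_in_probability_mult:
  assumes "tendsto_in_probability M Z Y"
  shows "tendsto_in_probability M (\<lambda>k \<omega>. c * Z k \<omega>) (\<lambda>\<omega>. c * Y \<omega>)"
proof (cases "c = 0")
  case True
  then show ?thesis by (simp add: tendsto_in_probability_def)
next
  case False
  have *: "\<epsilon> < \<bar>c * z - c * y\<bar> \<longleftrightarrow> \<epsilon> / \<bar>c\<bar> < \<bar>z - y\<bar>" for \<epsilon> z y :: real
    using False by (simp add: abs_mult mult.commute pos_divide_less_eq flip: right_diff_distrib)
  show ?thesis
    using assms False unfolding tendsto_in_probability_def * by simp
qed

lemma progressive_scaleR: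
  fixes X :: "real \<Rightarrow> 'w \<Rightarrow> 'b::{real_normed_vector, second_countable_topology}"
  assumes "progressive F J X"
  shows "progressive F J (\<lambda>t \<omega>. c *\<^sub>R X t \<omega>)"
  unfolding progressive_def
proof
  fix t
  assume "t \<in> J"
  with assms have [measurable]: "(\<lambda>(s, \<omega>). X s \<omega>)
      \<in> borel_measurable (restrict_space borel {0..t} \<Otimes>\<^sub>M F t)"
    unfolding progressive_def by blast
  have "(\<lambda>z. c *\<^sub>R (case z of (s, \<omega>) \<Rightarrow> X s \<omega>))
      \<in> borel_measurable (restrict_space borel {0..t} \<Otimes>\<^sub>M F t)"
    by measurable
  then show "(\<lambda>(s, \<omega>). c *\<^sub>R X s \<omega>) \<in> borel_measurable (restrict_space borel {0..t} \<Otimes>\<^sub>M F t)"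
    by (simp add: case_prod_unfold)
qed

lemma elementary_scaleR:
  assumes "elementary F n \<tau> \<xi>"
  shows "elementary F n \<tau> (\<lambda>i \<omega>. c *\<^sub>R \<xi> i \<omega>)"
  unfolding elementary_def
proof (intro conjI allI impI)
  fix i
  assume "i < n"
  with assms have \<xi>: "\<tau> i \<le> \<tau> (Suc i)" "\<xi> i \<in> borel_measurable (F (\<tau> i))"
    "\<exists>C. \<forall>\<omega>\<in>space (F (\<tau> i)). norm (\<xi> i \<omega>) \<le> C"
    unfolding elementary_def by blast+
  then show "\<tau> i \<le> \<tau> (Suc i)" "(\<lambda>\<omega>. c *\<^sub>R \<xi> i \<omega>) \<in> borel_measurable (F (\<tau> i))"
    by simp_all
  from \<xi>(3) obtain C where "\<forall>\<omega>\<in>space (F (\<tau> i)). norm (\<xi> i \<omega>) \<le> C" ..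
  then have "\<forall>\<omega>\<in>space (F (\<tau> i)). norm (c *\<^sub>R \<xi> i \<omega>) \<le> \<bar>c\<bar> * C"
    by (simp add: mult_left_mono)
  then show "\<exists>C. \<forall>\<omega>\<in>space (F (\<tau> i)). norm (c *\<^sub>R \<xi> i \<omega>) \<le> C" ..
qed (use assms in \<open>simp add: elementary_def\<close>)

lemma elementary_process_scaleR:
  "elementary_process n \<tau> (\<lambda>i \<omega>. c *\<^sub>R \<xi> i \<omega>) t \<omega> = c *\<^sub>R elementary_process n \<tau> \<xi> t \<omega>"
  unfolding elementary_process_def scaleR_sum_right by (intro sum.cong refl scaleR_left_commute)

lemma elementary_integral_scaleR:
  "elementary_integral W n \<tau> (\<lambda>i \<omega>. c *\<^sub>R \<xi> i \<omega>) t \<omega> = c * elementary_integral W n \<tau> \<xi> t \<omega>"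
  by (simp add: elementary_integral_def sum_distrib_left)

text \<open>Scaling the approximating elementary integrands by c multiplies their integrals by c and
  the squared distances to the integrand by c^2, so both limits in probability survive.\<close>

lemma ito_integral_scaleR:
  assumes "ito_integral M F W J H I"
  shows "ito_integral M F W J (\<lambda>t \<omega>. c *\<^sub>R H t \<omega>) (\<lambda>t \<omega>. c * I t \<omega>)"
proof -
  from assms have prog: "progressive F J H"
    and sq: "AE \<omega> in M. \<forall>t\<in>J. set_integrable lborel {0..t} (\<lambda>s. (norm (H s \<omega>))\<^sup>2)"
    and adap: "adapted F J I" and cont: "AE \<omega> in M. continuous_on J (\<lambda>t. I t \<omega>)"
    unfolding ito_integral_def by blast+
  from assms obtain n \<tau> \<xi> where el: "\<And>k. elementary F (n k) (\<tau> k) (\<xi> k)"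
    and lim: "\<And>t. t \<in> J \<Longrightarrow> tendsto_in_probability M
        (\<lambda>k \<omega>. LINT s:{0..t}|lborel.
          (norm (elementary_process (n k) (\<tau> k) (\<xi> k) s \<omega> - H s \<omega>))\<^sup>2) (\<lambda>\<omega>. 0)"
      "\<And>t. t \<in> J \<Longrightarrow> tendsto_in_probability M
        (\<lambda>k. elementary_integral W (n k) (\<tau> k) (\<xi> k) t) (I t)"
    unfolding ito_integral_def by blast
  have dist_scaleR: "(norm (c *\<^sub>R u - c *\<^sub>R v))\<^sup>2 = c\<^sup>2 * (norm (u - v))\<^sup>2" for u v :: "real^'b"
    by (simp add: power_mult_distrib flip: scaleR_diff_right)
  have "AE \<omega> in M. \<forall>t\<in>J. set_integrable lborel {0..t} (\<lambda>s. (norm (c *\<^sub>R H s \<omega>))\<^sup>2)"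
    using sq by eventually_elim (auto simp: power_mult_distrib)
  moreover have "adapted F J (\<lambda>t \<omega>. c * I t \<omega>)"
    using adap by (auto simp: adapted_def intro!: borel_measurable_times)
  moreover have "AE \<omega> in M. continuous_on J (\<lambda>t. c * I t \<omega>)"
    using cont by eventually_elim (intro continuous_intros)
  moreover have "tendsto_in_probability M
      (\<lambda>k \<omega>. LINT s:{0..t}|lborel. (norm (elementary_process (n k) (\<tau> k)
        (\<lambda>i \<omega>. c *\<^sub>R \<xi> k i \<omega>) s \<omega> - c *\<^sub>R H s \<omega>))\<^sup>2) (\<lambda>\<omega>. 0)"
    if "t \<in> J" for t
    using tendsto_in_probability_mult[OF lim(1)[OF that], of "c\<^sup>2"]
    by (simp add: elementary_process_scaleR dist_scaleR)
  moreover have "tendsto_in_probability M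
      (\<lambda>k. elementary_integral W (n k) (\<tau> k) (\<lambda>i \<omega>. c *\<^sub>R \<xi> k i \<omega>) t) (\<lambda>\<omega>. c * I t \<omega>)"
    if "t \<in> J" for t
    using tendsto_in_probability_mult[OF lim(2)[OF that], of c]
    by (simp add: elementary_integral_scaleR[abs_def])
  ultimately show ?thesis
    unfolding ito_integral_def using progressive_scaleR[OF prog, of c] elementary_scaleR[OF el]
    by (intro conjI exI[of _ n] exI[of _ \<tau>] exI[of _ "\<lambda>k i \<omega>. c *\<^sub>R \<xi> k i \<omega>"]) auto
qed

text \<open>Serves to multiply by - x at fixed x, where this factor is constant in time and
  outcome.\<close>

lemma has_ito_differential_scaleR:
  assumes "has_ito_differential M F W J X a b"
  shows "has_ito_differential M F W J
    (\<lambda>t \<omega>. c * X t \<omega>) (\<lambda>t \<omega>. c * a t \<omega>) (\<lambda>t \<omega>. c *\<^sub>R b t \<omega>)"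
proof -
  from assms obtain \<xi> \<alpha> \<beta> I where \<xi>: "\<xi> \<in> borel_measurable (F 0)"
    and \<alpha>: "progressive F J \<alpha>" and I: "ito_integral M F W J \<beta> I"
    and eq: "AE \<omega> in M. \<forall>t\<in>J. a t \<omega> = \<alpha> t \<omega> \<and> b t \<omega> = \<beta> t \<omega> \<and>
      set_integrable lborel {0..t} (\<lambda>s. \<alpha> s \<omega>) \<and>
      X t \<omega> = \<xi> \<omega> + (LINT s:{0..t}|lborel. \<alpha> s \<omega>) + I t \<omega>"
    unfolding has_ito_differential_def by blast
  have "AE \<omega> in M. \<forall>t\<in>J. c * a t \<omega> = c * \<alpha> t \<omega> \<and> c *\<^sub>R b t \<omega> = c *\<^sub>R \<beta> t \<omega> \<and>
      set_integrable lborel {0..t} (\<lambda>s. c * \<alpha> s \<omega>) \<and>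
      c * X t \<omega> = c * \<xi> \<omega> + (LINT s:{0..t}|lborel. c * \<alpha> s \<omega>) + c * I t \<omega>"
    using eq by eventually_elim (auto simp: distrib_left)
  moreover have "(\<lambda>\<omega>. c * \<xi> \<omega>) \<in> borel_measurable (F 0)" using \<xi> by simp
  moreover have "progressive F J (\<lambda>t \<omega>. c * \<alpha> t \<omega>)"
    using progressive_scaleR[OF \<alpha>, of c] by simp
  ultimately show ?thesis
    unfolding has_ito_differential_def using ito_integral_scaleR[OF I, of c] by blast
qed

text \<open>One null set must serve all times at once, as in the identification of coefficients
  within \<open>has_ito_differential\<close>.\<close>

lemma has_ito_differential_cong_AE:
  assumes "has_ito_differential M F W J X a b"
    and "AE \<omega> in M. \<forall>t\<in>J. a' t \<omega> = a t \<omega> \<and> b' t \<omega> = b t \<omega>"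
  shows "has_ito_differential M F W J X a' b'"
proof -
  from assms(1) obtain \<xi> \<alpha> \<beta> I where "\<xi> \<in> borel_measurable (F 0)" "progressive F J \<alpha>"
    "ito_integral M F W J \<beta> I"
    and eq: "AE \<omega> in M. \<forall>t\<in>J. a t \<omega> = \<alpha> t \<omega> \<and> b t \<omega> = \<beta> t \<omega> \<and>
      set_integrable lborel {0..t} (\<lambda>s. \<alpha> s \<omega>) \<and>
      X t \<omega> = \<xi> \<omega> + (LINT s:{0..t}|lborel. \<alpha> s \<omega>) + I t \<omega>"
    unfolding has_ito_differential_def by blast
  moreover have "AE \<omega> in M. \<forall>t\<in>J. a' t \<omega> = \<alpha> t \<omega> \<and> b' t \<omega> = \<beta> t \<omega> \<and>
      set_integrable lborel {0..t} (\<lambda>s. \<alpha> s \<omega>) \<and>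
      X t \<omega> = \<xi> \<omega> + (LINT s:{0..t}|lborel. \<alpha> s \<omega>) + I t \<omega>"
    using eq assms(2) by eventually_elim simp
  ultimately show ?thesis unfolding has_ito_differential_def by blast
qed

section \<open>The first principal moment\<close>

text \<open>The pathwise core, with t and \<omega> fixed: \<open>p\<close> and \<open>s\<close> are
  price and volatility as functions of time to maturity, \<open>d\<close> the drift,
  \<open>r\<close> the short rate, \<open>l\<close> the market price of risk, \<open>m\<close> the
  first moment.\<close>

lemma moment_drift_has_integral:
  fixes p d :: "real \<Rightarrow> real" and s :: "real \<Rightarrow> 'a::euclidean_space"
  assumes p: "smooth_from 0 p" and s: "smooth_from 0 s"
    and p0: "p 0 = 1" and p_lim: "(p \<longlongrightarrow> 0) at_top"
    and d: "\<And>x. 0 \<le> x \<Longrightarrow> d x = r * p x + s x \<bullet> l + deriv_from 0 p x"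
    and p'_lim: "((\<lambda>x. x * deriv_from 0 p x) \<longlongrightarrow> 0) at_top"
    and s_lim: "((\<lambda>x. x *\<^sub>R s x) \<longlongrightarrow> 0) at_top"
    and m: "((\<lambda>x. - x * deriv_from 0 p x) has_integral m) {0..}"
    and S: "(s has_integral S) {0..}"
  shows "((\<lambda>x. - x * deriv_from 0 d x) has_integral r * m - 1 + S \<bullet> l) {0..}"
proof -
  let ?p' = "deriv_from 0 p"
  note p_deriv = smooth_from_has_deriv_from[OF p]
  note p'_deriv = smooth_from_has_deriv_from[OF smooth_from_deriv_from[OF p]]
  note s_deriv = smooth_from_has_deriv_from[OF s]
  \<comment> \<open>The limit 0 at infinity minus p(0) = 1, that is, minus the total mass of the
    density.\<close>
  have "(?p' has_integral - 1) {0..}"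
    using fundamental_theorem_of_calculus_at_top[OF p_deriv p_lim] p0 by simp
  from has_integral_times_deriv_by_parts[OF p'_deriv _ this] p'_lim
  have p'_part: "((\<lambda>x. - x * deriv_from 0 ?p' x) has_integral - 1) {0..}" by simp
  \<comment> \<open>The inner product with the fixed vector \<open>l\<close> is bounded linear and
    so passes through the integral.\<close>
  from has_integral_linear[OF has_integral_times_deriv_by_parts[OF s_deriv s_lim S]
      bounded_linear_inner_left[of l]]
  have s_part: "((\<lambda>x. - x * (deriv_from 0 s x \<bullet> l)) has_integral S \<bullet> l) {0..}"
    by (simp add: o_def)
  have sum: "((\<lambda>x. r * (- x * ?p' x) + - x * (deriv_from 0 s x \<bullet> l) + - x * deriv_from 0 ?p' x)
      has_integral r * m + S \<bullet> l + - 1) {0..}"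
    by (intro has_integral_add has_integral_mult_right m s_part p'_part)
  have "deriv_from 0 d x = r * ?p' x + deriv_from 0 s x \<bullet> l + deriv_from 0 ?p' x" if "0 \<le> x" for x
  proof (rule deriv_from_eq)
    have "((\<lambda>x. r * p x + s x \<bullet> l + ?p' x) has_vector_derivative
        r * ?p' x + deriv_from 0 s x \<bullet> l + deriv_from 0 ?p' x) (at x within {0..})"
      by (intro has_vector_derivative_add has_vector_derivative_mult_right p_deriv p'_deriv that
          bounded_linear.has_vector_derivative[OF bounded_linear_inner_left] s_deriv)
    then show "(d has_vector_derivative
        r * ?p' x + deriv_from 0 s x \<bullet> l + deriv_from 0 ?p' x) (at x within {0..})"
      by (rule has_vector_derivative_transform[rotated 2]) (use that d in auto)
  qed fact
  then have "r * (- x * ?p' x) + - x * (deriv_from 0 s x \<bullet> l) + - x * deriv_from 0 ?p' x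
      = - x * deriv_from 0 d x" if "x \<in> {0..}" for x
    using that by (simp add: algebra_simps)
  from has_integral_eq[OF this sum] show ?thesis by (simp add: algebra_simps)
qed

theorem proposition3:
  fixes M :: "'w measure"
    and W :: "real \<Rightarrow> 'w \<Rightarrow> real^'d"
    and F :: "real \<Rightarrow> 'w measure"
    and P :: "real \<Rightarrow> real \<Rightarrow> 'w \<Rightarrow> real"
    and mu :: "real \<Rightarrow> real \<Rightarrow> 'w \<Rightarrow> real"
    and Sig :: "real \<Rightarrow> real \<Rightarrow> 'w \<Rightarrow> real^'d"
    and lam :: "real \<Rightarrow> 'w \<Rightarrow> real^'d"
  assumes "brownian_motion M W"
    and "F = brownian_filtration M W"
    and "bond_dynamics M F W P mu Sig"
    and "admissible M P"
    and "market_price_of_risk M F P mu Sig lam"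
    and "AE \<omega> in M. \<forall>t\<ge>0. Sig t t \<omega> = 0"
    and "regularity_conditions M F W P mu Sig"
    and "\<And>n. n \<in> {1, 2} \<Longrightarrow>
           AE \<omega> in M. \<forall>t\<ge>0. ((\<lambda>x. x ^ n * term_density P t x \<omega>) \<longlongrightarrow> 0) at_top"
    and "\<And>n. n \<in> {1, 2} \<Longrightarrow>
           AE \<omega> in M. \<forall>t\<ge>0. ((\<lambda>x. x ^ n *\<^sub>R Sig t (t + x) \<omega>) \<longlongrightarrow> 0) at_top"
    and "\<And>n. n \<in> {1, 2} \<Longrightarrow>
           AE \<omega> in M. \<forall>t\<ge>0. (\<lambda>x. x ^ n * term_density P t x \<omega>) integrable_on {0..}"
    and "\<And>n. n \<in> {1, 2} \<Longrightarrow>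
           AE \<omega> in M. \<forall>t\<ge>0. (\<lambda>x. x ^ (n - 1) *\<^sub>R Sig t (t + x) \<omega>) integrable_on {0..}"
  shows "has_ito_differential_star M F W lam {0..}
           (\<lambda>t \<omega>. integral {0..} (\<lambda>x. x * term_density P t x \<omega>))
           (\<lambda>t \<omega>. short_rate P t \<omega> * integral {0..} (\<lambda>x. x * term_density P t x \<omega>) - 1)
           (\<lambda>t \<omega>. integral {0..} (\<lambda>x. Sig t (t + x) \<omega>))"
proof -
  let ?p = "\<lambda>t \<omega> x. P t (t + x) \<omega>" and ?s = "\<lambda>t \<omega> x. Sig t (t + x) \<omega>"
  let ?xd = "\<lambda>t \<omega> x. - x * deriv_from 0 (\<lambda>y. maturity_drift P mu y t \<omega>) x"
  let ?xs = "\<lambda>t \<omega> x. - x *\<^sub>R deriv_from 0 (?s t \<omega>) x"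
  let ?m = "\<lambda>t \<omega>. integral {0..} (\<lambda>x. x * term_density P t x \<omega>)"
  let ?S = "\<lambda>t \<omega>. integral {0..} (?s t \<omega>)"
  let ?a = "\<lambda>t \<omega>. short_rate P t \<omega> * ?m t \<omega> - 1 + ?S t \<omega> \<bullet> lam t \<omega>"
  have p_smooth: "AE \<omega> in M. \<forall>t\<ge>0. smooth_from 0 (?p t \<omega>)"
    using assms(4) unfolding admissible_def
    by eventually_elim (auto intro: smooth_from_shift[where f = "\<lambda>T. P _ T _"])
  have coeff_smooth: "AE \<omega> in M. \<forall>t\<ge>0. smooth_from 0 (\<lambda>x. mu t (t + x) \<omega>) \<and> smooth_from 0 (?s t \<omega>)"
    using assms(3)[unfolded bond_dynamics_def, THEN conjunct2]
    by eventually_elim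
      (auto intro: smooth_from_shift[where f = "\<lambda>T. mu _ T _"] smooth_from_shift[where f = "\<lambda>T. Sig _ T _"])
  \<comment> \<open>The smoothness premise under which the regularity conditions allow
    differentiation in x.\<close>
  have "AE \<omega> in M. \<forall>t\<ge>0. smooth_from 0 (?p t \<omega>) \<and>
      smooth_from 0 (\<lambda>x. maturity_drift P mu x t \<omega>) \<and> smooth_from 0 (?s t \<omega>)"
    using p_smooth coeff_smooth
    by eventually_elim (auto simp: maturity_drift_def intro!: smooth_from_add smooth_from_deriv_from)
  then have deriv_diff: "has_ito_differential M F W {0..} (\<lambda>t \<omega>. deriv_from 0 (?p t \<omega>) x)
      (\<lambda>t \<omega>. deriv_from 0 (\<lambda>y. maturity_drift P mu y t \<omega>) x) (\<lambda>t \<omega>. deriv_from 0 (?s t \<omega>) x)"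
    if "0 \<le> x" for x
    using assms(7) that
    unfolding regularity_conditions_def differentiable_under_integral_signs_def by blast
  \<comment> \<open>Since \<rho> = - p', multiplying p' by - x gives the integrand of the first
    moment.\<close>
  have density_diff: "has_ito_differential M F W {0..} (\<lambda>t \<omega>. x * term_density P t x \<omega>)
      (\<lambda>t \<omega>. ?xd t \<omega> x) (\<lambda>t \<omega>. ?xs t \<omega> x)" if "0 \<le> x" for x
    using has_ito_differential_scaleR[OF deriv_diff[OF that], of "- x"]
    by (simp add: term_density_def)
  have m_int: "AE \<omega> in M. \<forall>t\<ge>0. (\<lambda>x. x * term_density P t x \<omega>) integrable_on {0..}"
    using assms(10)[of 1] by simp
  \<comment> \<open>The volatility integrals carry the exponent n - 1, so n = 1 gives the integral
    of the volatility itself.\<close>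
  have s_int: "AE \<omega> in M. \<forall>t\<ge>0. ?s t \<omega> integrable_on {0..}"
    using assms(11)[of 1] by simp
  have s_lim: "AE \<omega> in M. \<forall>t\<ge>0. ((\<lambda>x. x *\<^sub>R ?s t \<omega> x) \<longlongrightarrow> 0) at_top"
    using assms(9)[of 1] by simp
  have \<rho>_lim: "AE \<omega> in M. \<forall>t\<ge>0. ((\<lambda>x. x * term_density P t x \<omega>) \<longlongrightarrow> 0) at_top"
    using assms(8)[of 1] by simp
  have xs: "AE \<omega> in M. \<forall>t\<ge>0. (?xs t \<omega> has_integral ?S t \<omega>) {0..}"
    using coeff_smooth s_int s_lim
    by eventually_elim (blast intro: has_integral_times_deriv_by_parts
        smooth_from_has_deriv_from integrable_integral)
  \<comment> \<open>Finitely many almost sure statements, each uniform in t, are intersected; the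
    rest is calculus in x along one path.\<close>
  have xd: "AE \<omega> in M. \<forall>t\<ge>0. (?xd t \<omega> has_integral ?a t \<omega>) {0..}"
    using p_smooth coeff_smooth s_int s_lim m_int \<rho>_lim assms(4)[unfolded admissible_def]
      assms(5)[unfolded market_price_of_risk_def, THEN conjunct2]
  proof eventually_elim
    case (elim \<omega>)
    show ?case
    proof (intro allI impI)
      fix t :: real
      assume t: "0 \<le> t"
      have "((\<lambda>T. P t T \<omega>) \<longlongrightarrow> 0) at_top" using elim(7) t by blast
      from filterlim_compose[OF this filterlim_tendsto_add_at_top[OF tendsto_const filterlim_ident]]
      have p_lim: "(?p t \<omega> \<longlongrightarrow> 0) at_top" .
      show "(?xd t \<omega> has_integral ?a t \<omega>) {0..}"
      proof (rule moment_drift_has_integral[where p = "?p t \<omega>" and s = "?s t \<omega>"])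
        \<comment> \<open>Absence of arbitrage at maturity t + x replaces \<open>mu\<close>; neither
          the short rate nor \<open>lam\<close> depends on x.\<close>
        show "maturity_drift P mu x t \<omega> =
            short_rate P t \<omega> * ?p t \<omega> x + ?s t \<omega> x \<bullet> lam t \<omega> + deriv_from 0 (?p t \<omega>) x"
          if "0 \<le> x" for x
          using elim(8) t that by (simp add: maturity_drift_def)
        show "((\<lambda>x. x * deriv_from 0 (?p t \<omega>) x) \<longlongrightarrow> 0) at_top"
          using tendsto_minus[OF elim(6)[rule_format, OF t]] by (simp add: term_density_def)
        show "((\<lambda>x. - x * deriv_from 0 (?p t \<omega>) x) has_integral ?m t \<omega>) {0..}"
          using integrable_integral[OF elim(5)[rule_format, OF t]] by (simp add: term_density_def)
      qed (use elim t p_lim in \<open>auto intro: integrable_integral\<close>)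
    qed
  qed
  \<comment> \<open>Integrability of both coefficients comes from the integrals computed above,
    which unlocks integration in x under the integral signs.\<close>
  have "AE \<omega> in M. \<forall>t\<ge>0. (\<lambda>x. x * term_density P t x \<omega>) integrable_on {0..} \<and>
      ?xd t \<omega> integrable_on {0..} \<and> ?xs t \<omega> integrable_on {0..}"
    using m_int xs xd by eventually_elim (blast intro: has_integral_integrable)
  with density_diff assms(7)
  have "has_ito_differential M F W {0..} ?m
      (\<lambda>t \<omega>. integral {0..} (?xd t \<omega>)) (\<lambda>t \<omega>. integral {0..} (?xs t \<omega>))"
    unfolding regularity_conditions_def integrable_under_integral_signs_def by blast
  \<comment> \<open>\<open>?a\<close> is the claimed drift plus the inner product of
    \<open>?S\<close> and \<open>lam\<close>, which is what the passage from dW to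
    \<open>dW\<^sup>*\<close> adds.\<close>
  moreover have "AE \<omega> in M. \<forall>t\<in>{0..}. ?a t \<omega> = integral {0..} (?xd t \<omega>) \<and>
      ?S t \<omega> = integral {0..} (?xs t \<omega>)"
    using xs xd by eventually_elim (intro ballI conjI integral_unique[symmetric]; blast)
  ultimately show ?thesis
    unfolding has_ito_differential_star_def by (rule has_ito_differential_cong_AE)
qed

end
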